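(* Let $r\geq 4$ be a fixed integer. For integers $k\geq 2$, $a\geq rk-1$ and $n\geq (r-1)(k-1)+a$, let $\mathcal{H}=\mathcal{H}(n,k,a)$. Then the values of $$\frac{1}{r-1}\bigl(\operatorname{ecd}^r(\mathcal{H})-\operatorname{cd}^r(\mathcal{H})\bigr)\quad\text{and}\quad\frac{1}{r-1}\bigl(\operatorname{ecd}^r(\mathcal{H})-(n-\operatorname{alt}^r(\mathcal{H}))\bigr)$$ can be made as large as desired by making $k$ large enough; that is, for every real $M$ there is $k_0$ such that for all $k\geq k_0$ and all $a,n$ with $a\geq rk-1$ and $n\geq (r-1)(k-1)+a$, both values are at least $M$.
   Context: $[n]=\{1,\ldots,n\}$. $\mathcal{H}(n,k,a)$ is the hypergraph with vertex set $[n]$ whose edges are all $k$-element subsets $e$ of $[n]$ with $e\not\subseteq\{n-a+1,\ldots,n\}$. For a hypergraph $\mathcal{H}$ and $N\subseteq V(\mathcal{H})$, $\mathcal{H}[N]$ has vertex set $N$ and edge set $\{e\in E(\mathcal{H}): e\subseteq N\}$. A proper coloring of a hypergraph has no monochromatic edge. The $r$-colorability defect $\operatorname{cd}^r(\mathcal{H})$ is the minimum number of vertices that must be removed from $\mathcal{H}$ so that the induced subhypergraph on the remaining vertices is properly $r$-colorable. The equitable $r$-colorability defect $\operatorname{ecd}^r(\mathcal{H})$ is the minimum number of vertices that must be removed so that the induced subhypergraph on the remaining vertices has a proper coloring with $r$ (possibly empty) color classes whose sizes pairwise differ by at most one. Let $Z_r=\{\omega,\omega^2,\ldots,\omega^r\}$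 be the multiplicative cyclic group of order $r$ with generator $\omega$. For $X=(x_1,\ldots,x_n)\in(Z_r\cup\{0\})^n$, a subsequence $x_{i_1},\ldots,x_{i_m}$ ($1\leq i_1<\cdots<i_m\leq n$) of nonzero coordinates is alternating if any two consecutive terms are different; $\operatorname{alt}(X)$ is the length of a longest alternating subsequence of $X$ (and $\operatorname{alt}(\boldsymbol{0})=0$). Put $X^i=\{j\in[n]: x_j=\omega^i\}$ for $i\in[r]$. For a hypergraph $\mathcal{H}$ with $n$ vertices and a bijection $\sigma:[n]\to V(\mathcal{H})$, let $$\operatorname{alt}^r_\sigma(\mathcal{H})=\max\{\operatorname{alt}(X): X\in(Z_r\cup\{0\})^n,\ E(\mathcal{H}[\sigma(X^i)])=\varnothing\text{ for each } i\in[r]\},$$ and $\operatorname{alt}^r(\mathcal{H})=\min_\sigma\operatorname{alt}^r_\sigma(\mathcal{H})$, the minimum over all bijections $\sigma$. *)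

theory Defs
  imports Complex_Main "HOL-Library.FuncSet" "HOL-Library.Sublist"
begin

record 'a hypergraph =
  verts :: "'a set"
  hedges :: "'a set set"

definition induced :: "'a hypergraph \<Rightarrow> 'a set \<Rightarrow> 'a hypergraph" where
  "induced H N = \<lparr>verts = N, hedges = {e \<in> hedges H. e \<subseteq> N}\<rparr>"

definition H_nka :: "nat \<Rightarrow> nat \<Rightarrow> nat \<Rightarrow> nat hypergraph" where
  "H_nka n k a = \<lparr>verts = {1..n},
     hedges = {e. e \<subseteq> {1..n} \<and> card e = k \<and> \<not> e \<subseteq> {n - a + 1..n}}\<rparr>"

definition monochromatic :: "('a \<Rightarrow> nat) \<Rightarrow> 'a set \<Rightarrow> bool" where
  "monochromatic c e \<longleftrightarrow> (\<exists>i. \<forall>v\<in>e. c v = i)"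

definition proper_coloring :: "nat \<Rightarrow> 'a hypergraph \<Rightarrow> ('a \<Rightarrow> nat) \<Rightarrow> bool" where
  "proper_coloring r H c \<longleftrightarrow>
     c \<in> verts H \<rightarrow> {1..r} \<and> (\<forall>e\<in>hedges H. \<not> monochromatic c e)"

definition color_class :: "'a hypergraph \<Rightarrow> ('a \<Rightarrow> nat) \<Rightarrow> nat \<Rightarrow> 'a set" where
  "color_class H c i = {v \<in> verts H. c v = i}"

definition colorable :: "nat \<Rightarrow> 'a hypergraph \<Rightarrow> bool" where
  "colorable r H \<longleftrightarrow> (\<exists>c. proper_coloring r H c)"

definition equitably_colorable :: "nat \<Rightarrow> 'a hypergraph \<Rightarrow> bool" where
  "equitably_colorable r H \<longleftrightarrow>
     (\<exists>c. proper_coloring r H c \<and>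
        (\<forall>i\<in>{1..r}. \<forall>j\<in>{1..r}. card (color_class H c i) \<le> card (color_class H c j) + 1))"

text \<open>The defects and alternation numbers below are meant for finite hypergraphs without
  empty edge; then each \<open>Min\<close> and \<open>Max\<close> is taken over a finite nonempty set.\<close>

definition cd :: "nat \<Rightarrow> 'a hypergraph \<Rightarrow> nat" where
  "cd r H = Min {card R |R. R \<subseteq> verts H \<and> colorable r (induced H (verts H - R))}"

definition ecd :: "nat \<Rightarrow> 'a hypergraph \<Rightarrow> nat" where
  "ecd r H = Min {card R |R. R \<subseteq> verts H \<and> equitably_colorable r (induced H (verts H - R))}"

text \<open>An element of \<open>Z\<^sub>r \<union> {0}\<close> is encoded as a natural number in \<open>{0..r}\<close>: the number \<open>0\<close>
  stands for \<open>0\<close>, and \<open>i \<in> {1..r}\<close> stands for \<open>\<omega>\<^sup>i\<close>. The group operation plays no role here.\<close>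

definition sign_vectors :: "nat \<Rightarrow> nat \<Rightarrow> (nat \<Rightarrow> nat) set" where
  "sign_vectors r n = {1..n} \<rightarrow>\<^sub>E {0..r}"

definition alt :: "nat \<Rightarrow> (nat \<Rightarrow> nat) \<Rightarrow> nat" where
  "alt n X = Max {length ys |ys. subseq ys (map X [1..<n + 1]) \<and> 0 \<notin> set ys \<and> distinct_adj ys}"

definition level :: "nat \<Rightarrow> (nat \<Rightarrow> nat) \<Rightarrow> nat \<Rightarrow> nat set" where
  "level n X i = {j \<in> {1..n}. X j = i}"

definition alt_perm :: "nat \<Rightarrow> (nat \<Rightarrow> 'a) \<Rightarrow> 'a hypergraph \<Rightarrow> nat" where
  "alt_perm r \<sigma> H = (let n = card (verts H) in
     Max {alt n X |X. X \<in> sign_vectors r n \<and>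
            (\<forall>i\<in>{1..r}. hedges (induced H (\<sigma> ` level n X i)) = {})})"

definition alt_num :: "nat \<Rightarrow> 'a hypergraph \<Rightarrow> nat" where
  "alt_num r H = Min {alt_perm r \<sigma> H |\<sigma>. bij_betw \<sigma> {1..card (verts H)} (verts H)}"

end

(* Let A be the set of the last a vertices. In a properly coloured induced subhypergraph a colour
   class is either contained in A or has fewer than k vertices.
   If the colouring is equitable, then either all classes lie in A, or some class has fewer than k
   vertices, hence all have at most k and at most rk - 1 <= a vertices remain; both ways at most
   a vertices remain, so ecd >= n - a.
   Without equitability, A can be one class and the other r - 1 classes can have k - 1 vertices each
   outside A, so cd <= n - a - (r-1)(k-1).
   For any order of the vertices, let signs 1, 2 alternate along A and let the other r - 2 >= 2 signs
   rotate along (r-2)(k-1) vertices outside A. The resulting vector is alternating on its whole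
   support, so alt >= a + (r-2)(k-1). *)

theory Submission imports Defs begin

section \<open>Edges of the hypergraph and a counting bound\<close>

lemma mem_hedges_H_nka:
  "e \<in> hedges (H_nka n k a) \<longleftrightarrow> e \<subseteq> {1..n} \<and> card e = k \<and> \<not> e \<subseteq> {n - a + 1..n}"
  by (simp add: H_nka_def)

lemma verts_H_nka [simp]: "verts (H_nka n k a) = {1..n}"
  by (simp add: H_nka_def)

text \<open>Once the remainder modulo \<open>m\<close> is fixed, a value of \<open>f\<close> is
  determined by its quotient, and only \<open>q\<close> quotients are possible. This bounds how
  often one colour or sign occurs when \<open>m\<close> of them are dealt out cyclically to
  \<open>m * q\<close> places.\<close>

lemma card_le_if_mod_const:
  fixes f :: "'a \<Rightarrow> nat"
  assumes inj: "inj_on f S" and lt: "\<And>x. x \<in> S \<Longrightarrow> f x < m * q"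
    and md: "\<And>x. x \<in> S \<Longrightarrow> f x mod m = c"
  shows "card S \<le> q"
proof -
  have "inj_on (\<lambda>x. f x div m) S"
  proof (rule inj_onI)
    fix x y assume xy: "x \<in> S" "y \<in> S" "f x div m = f y div m"
    then have "f x = f y"
      using md[of x] md[of y] by (metis div_mult_mod_eq)
    then show "x = y" using inj xy by (auto dest: inj_onD)
  qed
  moreover have "(\<lambda>x. f x div m) ` S \<subseteq> {..<q}"
    using lt by (auto simp: less_mult_imp_div_less mult.commute)
  ultimately have "card S \<le> card {..<q}" by (intro card_inj_on_le) auto
  then show ?thesis by simp
qed

section \<open>Colorability defects\<close>

text \<open>If a class has \<open>k\<close> or more vertices and one of them lies outside the last
  \<open>a\<close>, then that vertex and any \<open>k - 1\<close> others of the class form a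
  monochromatic edge.\<close>

lemma proper_color_class_H_nka:
  assumes pc: "proper_coloring r (induced (H_nka n k a) N) c" and N: "N \<subseteq> {1..n}" and "k \<ge> 1"
  shows "color_class (induced (H_nka n k a) N) c i \<subseteq> {n - a + 1..n} \<or>
         card (color_class (induced (H_nka n k a) N) c i) < k"
proof (rule ccontr)
  let ?C = "color_class (induced (H_nka n k a) N) c i"
  assume "\<not> ?thesis"
  then have notA: "\<not> ?C \<subseteq> {n - a + 1..n}" and ge: "k \<le> card ?C" by auto
  have C: "?C \<subseteq> N" "\<And>v. v \<in> ?C \<Longrightarrow> c v = i"
    by (auto simp: color_class_def induced_def)
  have finC: "finite ?C" using C(1) N by (meson finite_atLeastAtMost finite_subset)
  obtain v where v: "v \<in> ?C" "v \<notin> {n - a + 1..n}" using notA by blast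
  have "k - 1 \<le> card (?C - {v})" using ge v finC by simp
  then obtain D where D: "D \<subseteq> ?C - {v}" "card D = k - 1"
    by (meson obtain_subset_with_card_n)
  have finD: "finite D" using D(1) finC by (meson finite_Diff finite_subset)
  have "card (insert v D) = k"
    using D finD \<open>k \<ge> 1\<close> by (subst card_insert_disjoint) auto
  moreover have "insert v D \<subseteq> N" using D v C(1) by blast
  ultimately have "insert v D \<in> hedges (induced (H_nka n k a) N)"
    using v N by (auto simp: induced_def mem_hedges_H_nka)
  moreover have "monochromatic c (insert v D)"
    unfolding monochromatic_def using C(2) v D by blast
  ultimately show False using pc by (auto simp: proper_coloring_def)
qed

lemma equitably_colorable_card_le:
  assumes ec: "equitably_colorable r (induced (H_nka n k a) N)" and N: "N \<subseteq> {1..n}"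
    and "k \<ge> 1" "r \<ge> 1" "a \<ge> r * k - 1"
  shows "card N \<le> a"
proof -
  let ?H = "induced (H_nka n k a) N"
  obtain c where pc: "proper_coloring r ?H c"
    and eq: "\<And>i j. i \<in> {1..r} \<Longrightarrow> j \<in> {1..r} \<Longrightarrow>
               card (color_class ?H c i) \<le> card (color_class ?H c j) + 1"
    using ec unfolding equitably_colorable_def by blast
  have V: "verts ?H = N" by (simp add: induced_def)
  have Nun: "N = (\<Union>i\<in>{1..r}. color_class ?H c i)"
    using pc V by (auto simp: color_class_def proper_coloring_def)
  show ?thesis
  proof (cases "\<exists>j\<in>{1..r}. card (color_class ?H c j) < k")
    case True
    then obtain j where j: "j \<in> {1..r}" "card (color_class ?H c j) < k" by blast
    have "card N \<le> (\<Sum>i\<in>{1..r}. card (color_class ?H c i))"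
      by (subst Nun) (rule card_UN_le, simp)
    also have "\<dots> = card (color_class ?H c j) + (\<Sum>i\<in>{1..r} - {j}. card (color_class ?H c i))"
      using j(1) by (simp add: sum.remove)
    \<comment> \<open>Class \<open>j\<close> has at most \<open>k - 1\<close> vertices, and
      equitability allows every other class at most one more, hence at most \<open>k\<close>. The
      total is exactly the threshold in the hypothesis on \<open>a\<close>.\<close>
    also have "\<dots> \<le> (k - 1) + (\<Sum>i\<in>{1..r} - {j}. k)"
      using j eq[OF _ j(1)] by (intro add_mono sum_mono) (auto, fastforce)
    also have "\<dots> = (k - 1) + (r - 1) * k" using j(1) by simp
    also have "\<dots> = r * k - 1" using \<open>k \<ge> 1\<close> \<open>r \<ge> 1\<close> by (cases r) auto
    finally show ?thesis using assms(5) by simp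
  next
    case False
    then have "N \<subseteq> {n - a + 1..n}"
      using proper_color_class_H_nka[OF pc N \<open>k \<ge> 1\<close>] by (subst Nun) blast
    then have "card N \<le> card {n - a + 1..n}" by (intro card_mono) auto
    then show ?thesis by simp
  qed
qed

lemma ecd_H_nka_ge:
  assumes "k \<ge> 1" "r \<ge> 1" "a \<ge> r * k - 1"
  shows "n - a \<le> ecd r (H_nka n k a)"
proof -
  let ?S = "{card R |R. R \<subseteq> verts (H_nka n k a) \<and>
              equitably_colorable r (induced (H_nka n k a) (verts (H_nka n k a) - R))}"
  have "finite ?S" by simp
  \<comment> \<open>Removing every vertex is admissible: no edge remains and all classes are empty.
    So the minimum is over a nonempty set.\<close>
  moreover have "card {1..n} \<in> ?S"
  proof -
    have "equitably_colorable r (induced (H_nka n k a) {})"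
      unfolding equitably_colorable_def using assms
      by (intro exI[of _ "\<lambda>_. 1"])
        (auto simp: proper_coloring_def induced_def color_class_def mem_hedges_H_nka)
    then show ?thesis by force
  qed
  moreover have "n - a \<le> x" if "x \<in> ?S" for x
  proof -
    obtain R where R: "x = card R" "R \<subseteq> {1..n}"
      "equitably_colorable r (induced (H_nka n k a) ({1..n} - R))"
      using \<open>x \<in> ?S\<close> by auto
    have "card ({1..n} - R) \<le> a"
      using equitably_colorable_card_le[OF R(3) _ assms] by blast
    moreover have "card ({1..n} - R) = n - card R"
      using R(2) by (simp add: card_Diff_subset finite_subset)
    ultimately show ?thesis using R(1) by simp
  qed
  ultimately show ?thesis unfolding ecd_def by (intro Min.boundedI) blast+
qed

lemma cd_H_nka_le:
  assumes "r \<ge> 2" "k \<ge> 1" "n \<ge> (r - 1) * (k - 1) + a"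
  shows "cd r (H_nka n k a) \<le> n - a - (r - 1) * (k - 1)"
proof -
  let ?q = "(r - 1) * (k - 1)"
  let ?H = "H_nka n k a"
  \<comment> \<open>The middle block is removed. The last \<open>a\<close> vertices form class 1,
    and colours 2 to \<open>r\<close> are dealt out cyclically to the first \<open>?q\<close>
    vertices. Since \<open>?q + a\<close> is at most \<open>n\<close>, these two blocks are
    disjoint.\<close>
  define R where "R = {?q + 1..n - a}"
  define c where "c = (\<lambda>v::nat. if v \<le> ?q then 2 + (v - 1) mod (r - 1) else 1)"
  have ran: "c v \<in> {1..r}" for v
  proof -
    have "(v - 1) mod (r - 1) < r - 1" using assms(1) by simp
    then have "2 + (v - 1) mod (r - 1) \<le> r" using assms(1) by linarith
    then show ?thesis using assms(1) unfolding c_def by auto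
  qed
  have "\<not> monochromatic c e" if e: "e \<subseteq> {1..n} - R" "card e = k" "\<not> e \<subseteq> {n - a + 1..n}" for e
  proof
    assume "monochromatic c e"
    then obtain i where i: "\<And>v. v \<in> e \<Longrightarrow> c v = i" by (auto simp: monochromatic_def)
    \<comment> \<open>An edge has a vertex outside the last \<open>a\<close>, which lies in the
      first block because \<open>R\<close> is gone. Its colour is not 1, so a monochromatic edge
      lies entirely in the first block, where each colour occurs at most \<open>k - 1\<close>
      times.\<close>
    obtain w where w: "w \<in> e" "w \<notin> {n - a + 1..n}" using e(3) by blast
    then have "w \<le> ?q" using e(1) by (force simp: R_def)
    then have "i \<noteq> 1" using i[OF w(1)] by (simp add: c_def)
    then have le: "v \<le> ?q" "(v - 1) mod (r - 1) = i - 2" if "v \<in> e" for v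
      using i[OF that] by (auto simp: c_def split: if_splits)
    have pos: "v \<ge> 1" if "v \<in> e" for v using e(1) that by auto
    have "card e \<le> k - 1"
    proof (rule card_le_if_mod_const)
      show "inj_on (\<lambda>v. v - 1) e" using pos by (intro inj_on_diff_nat) auto
      show "v - 1 < ?q" if "v \<in> e" for v using le(1)[OF that] pos[OF that] by simp
    qed (fact le(2))
    then show False using e(2) assms(2) by simp
  qed
  then have "proper_coloring r (induced ?H ({1..n} - R)) c"
    using ran by (auto simp: proper_coloring_def induced_def mem_hedges_H_nka)
  then have "colorable r (induced ?H ({1..n} - R))" by (auto simp: colorable_def)
  moreover have "R \<subseteq> {1..n}" by (auto simp: R_def)
  ultimately have "cd r ?H \<le> card R" unfolding cd_def by (intro Min_le) auto
  then show ?thesis by (simp add: R_def)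
qed

section \<open>Alternation number\<close>

lemma finite_alt_lengths:
  "finite {length ys |ys. subseq ys (map X [1..<n + 1]) \<and> 0 \<notin> set ys \<and> distinct_adj ys}"
  by (rule finite_subset[of _ "{..n}"]) (auto dest: list_emb_length)

lemma alt_le: "alt n X \<le> n"
proof -
  have "0 \<in> {length ys |ys. subseq ys (map X [1..<n + 1]) \<and> 0 \<notin> set ys \<and> distinct_adj ys}"
    by (auto intro!: exI[of _ "[]"])
  with finite_alt_lengths[of X n] show ?thesis
    unfolding alt_def by (subst Max_le_iff) (auto dest: list_emb_length)
qed

text \<open>If neighbouring nonzero entries, separated only by zeros, always differ, then the list
  of all nonzero entries is itself an alternating subsequence.\<close>

lemma alt_ge_card_support:
  assumes "\<And>i j. \<lbrakk>i \<in> {1..n}; j \<in> {1..n}; i < j; X i \<noteq> 0; X j \<noteq> 0;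
              \<And>l. i < l \<Longrightarrow> l < j \<Longrightarrow> X l = 0\<rbrakk> \<Longrightarrow> X i \<noteq> X j"
  shows "card {j \<in> {1..n}. X j \<noteq> 0} \<le> alt n X"
proof -
  define js where "js = filter (\<lambda>j. X j \<noteq> 0) [1..<n + 1]"
  have sorted: "sorted_wrt (<) js"
    unfolding js_def by (intro sorted_wrt_filter sorted_wrt_upt)
  have set_js: "set js = {j \<in> {1..n}. X j \<noteq> 0}" by (auto simp: js_def)
  have "distinct_adj (map X js)"
    unfolding distinct_adj_conv_nth
  proof (intro allI impI)
    fix i assume "Suc i < length (map X js)"
    then have i: "Suc i < length js" by simp
    have mem: "js ! i \<in> set js" "js ! Suc i \<in> set js" using i by auto
    \<comment> \<open>A nonzero entry strictly between would have its own place in the sorted list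
      \<open>js\<close>, strictly between places \<open>i\<close> and \<open>Suc i\<close>.\<close>
    have "X l = 0" if l: "js ! i < l" "l < js ! Suc i" for l
    proof (rule ccontr)
      assume "X l \<noteq> 0"
      then have "l \<in> set js" using l mem unfolding set_js by auto
      then obtain m where m: "m < length js" "js ! m = l" by (auto simp: in_set_conv_nth)
      have "i < m" using l(1) m sorted i
        by (metis Suc_lessD linorder_neqE_nat order_less_asym sorted_wrt_nth_less)
      moreover have "m < Suc i" using l(2) m sorted i
        by (metis linorder_neqE_nat order_less_asym sorted_wrt_nth_less)
      ultimately show False by simp
    qed
    moreover have "js ! i < js ! Suc i" using sorted i by (simp add: sorted_wrt_nth_less)
    ultimately have "X (js ! i) \<noteq> X (js ! Suc i)"
      using assms mem unfolding set_js by blast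
    then show "map X js ! i \<noteq> map X js ! Suc i" using i by simp
  qed
  moreover have "subseq (map X js) (map X [1..<n + 1])"
    unfolding js_def by (intro subseq_map) simp
  moreover have "0 \<notin> set (map X js)" by (auto simp: js_def)
  ultimately have "length (map X js) \<le> alt n X"
    unfolding alt_def by (intro Max_ge finite_alt_lengths) blast
  moreover have "length js = card (set js)"
    unfolding js_def by (intro distinct_card[symmetric] distinct_filter distinct_upt)
  ultimately show ?thesis by (simp add: set_js)
qed

lemma alt_perm_ge:
  assumes "X \<in> sign_vectors r (card (verts H))"
    and "\<And>i. i \<in> {1..r} \<Longrightarrow> hedges (induced H (\<sigma> ` level (card (verts H)) X i)) = {}"
  shows "alt (card (verts H)) X \<le> alt_perm r \<sigma> H"
proof -
  have "finite (sign_vectors r (card (verts H)))"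
    unfolding sign_vectors_def by (intro finite_PiE) auto
  then show ?thesis
    unfolding alt_perm_def Let_def using assms by (intro Max_ge) auto
qed

text \<open>Bounding these values makes the set of them finite, as the minimum in
  \<open>alt_num\<close> requires. The assumption ensures that the maximum is over a nonempty
  set.\<close>

lemma alt_perm_le:
  assumes "\<exists>X. X \<in> sign_vectors r (card (verts H)) \<and>
      (\<forall>i\<in>{1..r}. hedges (induced H (\<sigma> ` level (card (verts H)) X i)) = {})"
  shows "alt_perm r \<sigma> H \<le> card (verts H)"
proof -
  have "finite (sign_vectors r (card (verts H)))"
    unfolding sign_vectors_def by (intro finite_PiE) auto
  then show ?thesis
    unfolding alt_perm_def Let_def using assms by (subst Max_le_iff) (auto simp: alt_le)
qed

section \<open>Ranks: zero-based positions of elements within a finite set\<close>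

definition rank :: "nat set \<Rightarrow> nat \<Rightarrow> nat" where
  "rank S j = card {i \<in> S. i < j}"

lemma rank_less_card: "finite S \<Longrightarrow> j \<in> S \<Longrightarrow> rank S j < card S"
  unfolding rank_def by (intro psubset_card_mono) auto

lemma rank_strict_mono: "finite S \<Longrightarrow> i \<in> S \<Longrightarrow> i < j \<Longrightarrow> rank S i < rank S j"
  unfolding rank_def by (intro psubset_card_mono) auto

lemma inj_on_rank: "finite S \<Longrightarrow> inj_on (rank S) S"
  by (rule inj_onI) (metis linorder_neqE_nat order_less_irrefl rank_strict_mono)

text \<open>The only element of \<open>S\<close> below \<open>j\<close> but not below
  \<open>i\<close> is \<open>i\<close> itself. Together with the next lemma, neighbours in
  \<open>S\<close> receive different signs when signs are assigned by rank modulo at least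
  2.\<close>

lemma rank_next:
  assumes "finite S" "i \<in> S" "i < j" "\<And>l. i < l \<Longrightarrow> l < j \<Longrightarrow> l \<notin> S"
  shows "rank S j = Suc (rank S i)"
proof -
  have "{l \<in> S. l < j} = insert i {l \<in> S. l < i}"
    using assms(2-4) by (auto simp: not_less) (metis linorder_neqE_nat)
  then show ?thesis using assms(1) by (simp add: rank_def)
qed

lemma Suc_mod_neq: "m \<ge> 2 \<Longrightarrow> Suc q mod m \<noteq> q mod m"
  by (auto simp: mod_Suc)

section \<open>An alternating vector for an arbitrary vertex order\<close>

lemma exists_alternating_vector:
  assumes "r \<ge> 4" "k \<ge> 1" "a \<le> n" "n \<ge> (r - 2) * (k - 1) + a"
    and bij: "bij_betw \<sigma> {1..n} {1..n}"
  shows "\<exists>X\<in>sign_vectors r n. a + (r - 2) * (k - 1) \<le> alt n X \<and>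
           (\<forall>i\<in>{1..r}. hedges (induced (H_nka n k a) (\<sigma> ` level n X i)) = {})"
proof -
  let ?A = "{n - a + 1..n}"
  \<comment> \<open>\<open>P\<close> collects positions, not vertices: \<open>\<sigma>\<close> may
    scatter the last \<open>a\<close> vertices over the whole order.\<close>
  define P where "P = {j \<in> {1..n}. \<sigma> j \<in> ?A}"
  have finP: "finite P" by (simp add: P_def)
  have "\<sigma> ` P = \<sigma> ` {1..n} \<inter> ?A" unfolding P_def by blast
  also have "\<dots> = ?A" using bij by (auto simp: bij_betw_def)
  finally have "\<sigma> ` P = ?A" .
  moreover have "inj_on \<sigma> P"
    using bij_betw_imp_inj_on[OF bij] by (rule inj_on_subset) (auto simp: P_def)
  ultimately have cardP: "card P = a" using card_image[of \<sigma> P] assms(3) by simp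
  have "card ({1..n} - P) = n - a"
    using cardP finP by (subst card_Diff_subset) (auto simp: P_def)
  then have "(r - 2) * (k - 1) \<le> card ({1..n} - P)" using assms(4) by simp
  then obtain T where T: "T \<subseteq> {1..n} - P" "card T = (r - 2) * (k - 1)" "finite T"
    by (meson obtain_subset_with_card_n)
  \<comment> \<open>Ranks are taken in \<open>P\<close> and in \<open>T\<close> separately, so each
    set runs through its own signs (1, 2 on \<open>P\<close> and 3 to \<open>r\<close> on
    \<open>T\<close>) however the two sets interleave.\<close>
  define X where "X = (\<lambda>j\<in>{1..n}. if j \<in> P then 1 + rank P j mod 2
                        else if j \<in> T then 3 + rank T j mod (r - 2) else 0)"
  have PT: "P \<subseteq> {1..n}" "T \<subseteq> {1..n}" "P \<inter> T = {}" using T(1) by (auto simp: P_def)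
  have XP: "X j = 1 + rank P j mod 2" if "j \<in> P" for j using that PT by (auto simp: X_def)
  have XT: "X j = 3 + rank T j mod (r - 2)" if "j \<in> T" for j using that PT by (auto simp: X_def)
  have X0: "X j = 0" if "j \<in> {1..n}" "j \<notin> P" "j \<notin> T" for j using that by (auto simp: X_def)
  have P_less: "X j < 3" if "j \<in> P" for j
    using XP[OF that] mod_less_divisor[of 2 "rank P j"] by linarith
  have "X j \<in> {0..r}" if "j \<in> {1..n}" for j
  proof -
    have "rank T j mod (r - 2) < r - 2" using assms(1) by simp
    then have "3 + rank T j mod (r - 2) \<le> r" by linarith
    then show ?thesis using X0[OF that] XT[of j] P_less[of j] assms(1)
      by (cases "j \<in> P"; cases "j \<in> T") auto
  qed
  then have "X \<in> sign_vectors r n"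
    by (auto simp: sign_vectors_def PiE_iff X_def)
  moreover have "a + (r - 2) * (k - 1) \<le> alt n X"
  proof -
    have "{j \<in> {1..n}. X j \<noteq> 0} = P \<union> T"
      using PT X0 XP XT by force
    then have "card {j \<in> {1..n}. X j \<noteq> 0} = a + (r - 2) * (k - 1)"
      using finP T PT cardP by (simp add: card_Un_disjoint)
    moreover have "card {j \<in> {1..n}. X j \<noteq> 0} \<le> alt n X"
    proof (rule alt_ge_card_support)
      fix i j
      assume ij: "i \<in> {1..n}" "j \<in> {1..n}" "i < j" "X i \<noteq> 0" "X j \<noteq> 0"
        and gap: "\<And>l. i < l \<Longrightarrow> l < j \<Longrightarrow> X l = 0"
      have gap': "l \<notin> P" "l \<notin> T" if "i < l" "l < j" for l
        using gap[OF that] XP[of l] XT[of l] by auto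
      \<comment> \<open>Two neighbours from the same set have consecutive ranks there, by
        \<open>gap'\<close>. Neighbours from different sets differ because signs on \<open>P\<close>
        are below 3 and those on \<open>T\<close> are not.\<close>
      consider "i \<in> P" "j \<in> P" | "i \<in> T" "j \<in> T" | "i \<in> P" "j \<in> T" | "i \<in> T" "j \<in> P"
        using X0[OF ij(1)] X0[OF ij(2)] ij(4,5) by argo
      then show "X i \<noteq> X j"
      proof cases
        case 1
        then have "rank P j = Suc (rank P i)"
          using rank_next[OF finP] ij(3) gap'(1) by blast
        then show ?thesis using 1 XP Suc_mod_neq[of 2 "rank P i"] by simp
      next
        case 2
        then have "rank T j = Suc (rank T i)"
          using rank_next[OF T(3)] ij(3) gap'(2) by blast
        \<comment> \<open>Here \<open>r \<ge> 4\<close> is used in full: rotation on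
          \<open>T\<close> needs at least two signs besides 1 and 2.\<close>
        moreover have "r - 2 \<ge> 2" using assms(1) by simp
        ultimately show ?thesis using 2 XT Suc_mod_neq[of "r - 2" "rank T i"] by simp
      next
        case 3
        then show ?thesis using P_less[of i] XT[of j] by simp
      next
        case 4
        then show ?thesis using P_less[of j] XT[of i] by simp
      qed
    qed
    ultimately show ?thesis by simp
  qed
  moreover have "hedges (induced (H_nka n k a) (\<sigma> ` level n X i)) = {}" if i: "i \<in> {1..r}" for i
  proof (cases "i < 3")
    case True
    \<comment> \<open>Signs 1 and 2 mark only vertices among the last \<open>a\<close>, a set that
      contains no edge.\<close>
    have "level n X i \<subseteq> P"
      using True i X0 XT by (force simp: level_def)
    then have "\<sigma> ` level n X i \<subseteq> ?A" by (auto simp: P_def)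
    then show ?thesis by (simp add: induced_def mem_hedges_H_nka) blast
  next
    case False
    have sub: "level n X i \<subseteq> T"
      using False i X0 P_less by (force simp: level_def)
    \<comment> \<open>Each of the remaining \<open>r - 2\<close> signs occurs at most
      \<open>k - 1\<close> times, too few for an edge.\<close>
    have "card (level n X i) \<le> k - 1"
    proof (rule card_le_if_mod_const)
      show "inj_on (rank T) (level n X i)" using inj_on_rank[OF T(3)] sub by (rule inj_on_subset)
      show "rank T j < (r - 2) * (k - 1)" if "j \<in> level n X i" for j
        using rank_less_card[OF T(3)] sub that T(2) by auto
      show "rank T j mod (r - 2) = i - 3" if "j \<in> level n X i" for j
        using that XT[of j] sub by (auto simp: level_def)
    qed
    moreover have fin: "finite (level n X i)" by (simp add: level_def)
    ultimately have "card (\<sigma> ` level n X i) < k"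
      using card_image_le[OF fin, of \<sigma>] assms(2) by simp
    then have "card e < k" if "e \<subseteq> \<sigma> ` level n X i" for e
      using card_mono[OF finite_imageI[OF fin] that] by simp
    then show ?thesis by (auto simp: induced_def mem_hedges_H_nka)
  qed
  ultimately show ?thesis by blast
qed

lemma alt_num_H_nka_ge:
  assumes "r \<ge> 4" "k \<ge> 1" "n \<ge> (r - 2) * (k - 1) + a"
  shows "a + (r - 2) * (k - 1) \<le> alt_num r (H_nka n k a)"
proof -
  let ?H = "H_nka n k a"
  let ?S = "{alt_perm r \<sigma> ?H |\<sigma>. bij_betw \<sigma> {1..card (verts ?H)} (verts ?H)}"
  have "a \<le> n" using assms(3) by simp
  have bounds: "a + (r - 2) * (k - 1) \<le> alt_perm r \<sigma> ?H \<and> alt_perm r \<sigma> ?H \<le> n"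
    if "bij_betw \<sigma> {1..n} {1..n}" for \<sigma>
  proof -
    obtain X where X: "X \<in> sign_vectors r n" "a + (r - 2) * (k - 1) \<le> alt n X"
      "\<forall>i\<in>{1..r}. hedges (induced ?H (\<sigma> ` level n X i)) = {}"
      using exists_alternating_vector[OF assms(1,2) \<open>a \<le> n\<close> assms(3) \<open>bij_betw \<sigma> _ _\<close>] by blast
    have "alt n X \<le> alt_perm r \<sigma> ?H"
      using alt_perm_ge[of X r ?H \<sigma>] X by simp
    moreover have "alt_perm r \<sigma> ?H \<le> n"
      using alt_perm_le[of r ?H \<sigma>] X by auto
    ultimately show ?thesis using X(2) by simp
  qed
  \<comment> \<open>There are infinitely many such \<open>\<sigma>\<close>, since values outside the
    index range are arbitrary. Finiteness comes from the upper bound \<open>n\<close> on the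
    values.\<close>
  have "finite ?S" by (rule finite_subset[of _ "{..n}"]) (use bounds in auto)
  moreover have "?S \<noteq> {}" using bij_betw_id[of "{1..n}"] by auto
  ultimately show ?thesis
    unfolding alt_num_def using bounds by (subst Min_ge_iff) auto
qed

section \<open>Both normalised gaps grow with k\<close>

theorem mainTheorem6:
  fixes r :: nat
  assumes "r \<ge> 4"
  shows "\<forall>M::real. \<exists>k0::nat. \<forall>k\<ge>k0. \<forall>a n :: nat.
           k \<ge> 2 \<longrightarrow> a \<ge> r * k - 1 \<longrightarrow> n \<ge> (r - 1) * (k - 1) + a \<longrightarrow>
             1 / (real r - 1) * (real (ecd r (H_nka n k a)) - real (cd r (H_nka n k a))) \<ge> M \<and>
             1 / (real r - 1) * (real (ecd r (H_nka n k a))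
                 - (real n - real (alt_num r (H_nka n k a)))) \<ge> M"
proof (intro allI exI impI)
  fix M :: real and k a n :: nat
  \<comment> \<open>The factor 2 pays for the ratio of \<open>r - 2\<close> to \<open>r - 1\<close>,
    which is at least one half. The summand 1 turns \<open>k\<close> into \<open>k - 1\<close>, and
    the absolute value covers negative \<open>M\<close>.\<close>
  assume kM: "k \<ge> nat \<lceil>2 * \<bar>M\<bar>\<rceil> + 1" and "k \<ge> 2" and a: "a \<ge> r * k - 1"
    and n: "n \<ge> (r - 1) * (k - 1) + a"
  let ?H = "H_nka n k a"
  have M: "real k - 1 \<ge> 2 * \<bar>M\<bar>" using kM by linarith
  have ecd: "n - a \<le> ecd r ?H" using ecd_H_nka_ge[of k r a n] assms \<open>k \<ge> 2\<close> a by simp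
  have cd: "cd r ?H \<le> n - a - (r - 1) * (k - 1)"
    using cd_H_nka_le[of r k a n] assms \<open>k \<ge> 2\<close> n by simp
  have "(r - 2) * (k - 1) \<le> (r - 1) * (k - 1)" by (intro mult_right_mono) auto
  then have alt: "a + (r - 2) * (k - 1) \<le> alt_num r ?H"
    using assms \<open>k \<ge> 2\<close> n by (intro alt_num_H_nka_ge) linarith+
  \<comment> \<open>The lower bound on \<open>n\<close> makes the truncated difference in
    \<open>cd\<close> exact, so \<open>n - a\<close> cancels.\<close>
  have "real (ecd r ?H) - real (cd r ?H) \<ge> real ((r - 1) * (k - 1))"
    using ecd cd n by linarith
  then have 1: "real (ecd r ?H) - real (cd r ?H) \<ge> (real r - 1) * (real k - 1)"
    using assms \<open>k \<ge> 2\<close> by (simp add: of_nat_diff)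
  have "real (ecd r ?H) - (real n - real (alt_num r ?H)) \<ge> real ((r - 2) * (k - 1))"
    using ecd alt n by linarith
  then have 2: "real (ecd r ?H) - (real n - real (alt_num r ?H)) \<ge> (real r - 2) * (real k - 1)"
    using assms \<open>k \<ge> 2\<close> by (simp add: of_nat_diff)
  have "M * (real r - 1) \<le> (real k - 1) / 2 * (real r - 1)"
    using M assms by (intro mult_right_mono) auto
  also have "\<dots> = (real k - 1) * ((real r - 1) / 2)" by simp
  finally have le: "M * (real r - 1) \<le> (real k - 1) * ((real r - 1) / 2)" .
  also have "\<dots> \<le> (real k - 1) * (real r - 1)"
    using M assms by (intro mult_left_mono) auto
  finally have "M * (real r - 1) \<le> real (ecd r ?H) - real (cd r ?H)"
    using 1 by (simp add: mult.commute)
  \<comment> \<open>Half of \<open>r - 1\<close> is at most \<open>r - 2\<close> because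
    \<open>r\<close> is at least 3.\<close>
  moreover have "(real k - 1) * ((real r - 1) / 2) \<le> (real k - 1) * (real r - 2)"
    using M assms by (intro mult_left_mono) auto
  then have "M * (real r - 1) \<le> real (ecd r ?H) - (real n - real (alt_num r ?H))"
    using le 2 by (simp add: mult.commute)
  ultimately show "1 / (real r - 1) * (real (ecd r ?H) - real (cd r ?H)) \<ge> M \<and>
      1 / (real r - 1) * (real (ecd r ?H) - (real n - real (alt_num r ?H))) \<ge> M"
    using assms by (simp add: pos_le_divide_eq)
qed

end
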